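(* Suppose that the regularity assumption (A-reg), controllability (A-ctrl), the full-rank assumption (A-rank), Slater's condition (A-Slater) and the normality assumption (A-normal) hold for problem (P8) with parameter $q=0$. Then there exists $\epsilon>0$ such that for every $q\in\epsilon\mathbb{D}=\{q\in\mathbb{R}^d:-\epsilon\le q_i\le\epsilon\ \forall i\}$ all of these assumptions hold for problem (P8) with parameter $q$.
   Context: Data: $A\in\mathbb{R}^{n_x\times n_x}$, $B\in\mathbb{R}^{n_x\times n_u}$, $x_{\rm init}\in\mathbb{R}^{n_x}$, $N\ge1$, reals $\rho_{\min},\rho_{\max}$; functions $m:\mathbb{R}^{n_x}\to\mathbb{R}$, $g:\mathbb{R}^{n_u}\to\mathbb{R}$, $l_i:\mathbb{R}\to\mathbb{R}$ ($i=1,\dots,N$) convex and $C^1$; $G:\mathbb{R}^{n_x}\to\mathbb{R}^{n_G}$ affine. Perturbation: let $A=Q^{-1}JQ$ be a Jordan decomposition and $\lambda_1,\dots,\lambda_d$ the distinct eigenvalues of $A$. For $q\in\mathbb{R}^d$, $\tilde A(q)=Q^{-1}\tilde JQ$, where $\tilde J$ is obtained from $J$ by replacing, in every Jordan block belonging to $\lambda_i$, the diagonal entry $\lambda_i$ by $\lambda_i+q_i$, leaving everything else unchanged; so $\tilde A(0)=A$. Problems are posed over the reals, so $\tilde A(q)$ is taken to be a real matrix. Problem (P8) with parameter $q$: minimize $m(x_{N+1})+\sum_{i=1}^N l_i(\sigma_i)$ over $x=(x_1,\dots,x_{N+1})$, $u=(u_1,\dots,u_N)$, $\sigma=(\sigma_1,\dots,\sigma_N)$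 with $x_i\in\mathbb{R}^{n_x}$, $u_i\in\mathbb{R}^{n_u}$, $\sigma_i\in\mathbb{R}$, subject to $x_{i+1}=\tilde A(q)x_i+Bu_i$, $\rho_{\min}\le\sigma_i\le\rho_{\max}$, $g(u_i)\le\sigma_i$ for $i=1,\dots,N$, $x_1=x_{\rm init}$, $G(x_{N+1})=0$. Problem (P7): minimize $m(x_{N+1})$ over $x_{N+1}\in\mathbb{R}^{n_x}$ subject to $G(x_{N+1})=0$. Write $z=(x,u,\sigma)$, $V=\{(\bar u,\bar\sigma):\rho_{\min}\le\bar\sigma\le\rho_{\max},\ g(\bar u)\le\bar\sigma\}$, $\tilde V=\{z:(u_i,\sigma_i)\in V\ \forall i\}$, and let $\tilde H(z,q)=0$ collect all affine equality constraints of (P8) (dynamics, initial condition, boundary condition). Assumptions for (P8) with parameter $q$. (A-reg): each $l_i$ is $C^1$ and strictly increasing on $[\rho_{\min},\infty)$; $m$ is $C^1$; $\{u: g(u_i)\le\rho_{\min}\ \forall i\}$ is nonempty and $\{u: g(u_i)\le\rho_{\max}\ \forall i\}$ is compact. (A-ctrl): $\operatorname{rank}(B,\tilde A(q)B,\dots,\tilde A(q)^{n_x-1}B)=n_x$. (A-rank): the Jacobian $\nabla_z\tilde H(\cdot,q)$ (constant in $z$) has full row rank. (A-Slater): there is $z$ in the interior of $\tilde V$ with $\tilde H(z,q)=0$. (A-normal): for an optimal solution $(x^*,u^*,\sigma^* )$ of (P8), either $\sigma_i^*>\rho_{\min}$ for some $i$, or $x^*_{N+1}$ is not a minimizer of (P7).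 *)

theory Defs
  imports "Jordan_Normal_Form.Jordan_Normal_Form" "HOL-Analysis.Analysis"
begin

no_notation Matrix.vec_index (infixl "$" 100)
no_notation Matrix.scalar_prod (infix "\<bullet>" 70)

section \<open>Perturbing the eigenvalues in a Jordan decomposition\<close>

text \<open>
  A bijection \<open>idx\<close> from the index type onto \<open>{..<n}\<close> numbers the coordinates of \<open>\<complex>^n\<close>.
  The list \<open>bs\<close> describes the Jordan blocks: an entry \<open>(k, i)\<close> is a block of size \<open>k\<close> belonging
  to the eigenvalue \<open>lam i\<close>.  All blocks with the same \<open>i\<close> are shifted by the same \<open>q $ i\<close>;
  the superdiagonal ones stay as they are.
\<close>

definition pert_jordan ::
  "('n::finite \<Rightarrow> nat) \<Rightarrow> (nat \<times> 'd::finite) list \<Rightarrow> ('d \<Rightarrow> complex) \<Rightarrow> real^'d \<Rightarrow> complex^'n^'n" where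
  "pert_jordan idx bs lam q =
     (\<chi> r c. jordan_matrix (map (\<lambda>(k, i). (k, lam i + of_real (q $ i))) bs) $$ (idx r, idx c))"

definition pert_matrix ::
  "('n::finite \<Rightarrow> nat) \<Rightarrow> complex^'n^'n \<Rightarrow> (nat \<times> 'd::finite) list \<Rightarrow> ('d \<Rightarrow> complex) \<Rightarrow> real^'d
     \<Rightarrow> complex^'n^'n" where
  "pert_matrix idx Q bs lam q = matrix_inv Q ** pert_jordan idx bs lam q ** Q"

definition eigenvalues_of :: "complex^'n^'n \<Rightarrow> complex set" where
  "eigenvalues_of M = {\<mu>. \<exists>v. v \<noteq> 0 \<and> M *v v = \<mu> *s v}"

text \<open>\<open>A = Q\<^sup>-\<^sup>1 J Q\<close> over \<open>\<complex>\<close>, with \<open>lam\<close> listing the distinct eigenvalues of \<open>A\<close>.\<close>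

definition jordan_decomposition ::
  "('n::finite \<Rightarrow> nat) \<Rightarrow> real^'n^'n \<Rightarrow> complex^'n^'n \<Rightarrow> (nat \<times> 'd::finite) list \<Rightarrow> ('d \<Rightarrow> complex)
     \<Rightarrow> bool" where
  "jordan_decomposition idx A Q bs lam \<longleftrightarrow>
     invertible Q \<and>
     (\<forall>(k, i) \<in> set bs. k > 0) \<and> sum_list (map fst bs) = CARD('n) \<and>
     inj lam \<and> range lam = eigenvalues_of (map_matrix of_real A) \<and>
     map_matrix of_real A = pert_matrix idx Q bs lam 0"

definition real_matrix :: "complex^'n^'m \<Rightarrow> bool" where
  "real_matrix M \<longleftrightarrow> (\<forall>i j. M $ i $ j \<in> \<real>)"

text \<open>Meant for matrices satisfying \<open>real_matrix\<close>, for which it only changes the type.\<close>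

definition to_real_matrix :: "complex^'n^'m \<Rightarrow> real^'n^'m" where
  "to_real_matrix M = map_matrix Re M"

section \<open>The optimal control problem\<close>

definition cont_differentiable :: "('a::real_normed_vector \<Rightarrow> 'b::real_normed_vector) \<Rightarrow> bool" where
  "cont_differentiable f \<longleftrightarrow>
     (\<exists>f'. (\<forall>x. (f has_derivative blinfun_apply (f' x)) (at x)) \<and> continuous_on UNIV f')"

definition affine_map :: "('a::real_vector \<Rightarrow> 'b::real_vector) \<Rightarrow> bool" where
  "affine_map f \<longleftrightarrow> (\<exists>L c. linear L \<and> f = (\<lambda>x. L x + c))"

text \<open>
  The problem data apart from the system matrix.  The type \<open>'t\<close> indexes the \<open>N\<close> stages, with
  \<open>stage t \<in> {1..N}\<close> the number of stage \<open>t\<close>; the type \<open>'s\<close> indexes the \<open>N + 1\<close> states, with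
  \<open>node i\<close> the index of \<open>x\<^sub>i\<close>.  Thus \<open>x\<^sub>i\<close> is \<open>x $ node i\<close>, while \<open>u\<^sub>i\<close>, \<open>\<sigma>\<^sub>i\<close>, \<open>l\<^sub>i\<close> for
  \<open>i = stage t\<close> are \<open>u $ t\<close>, \<open>\<sigma> $ t\<close>, \<open>stage_cost P t\<close>.
\<close>

record ('n, 'u, 'g, 's, 't) problem =
  horizon :: nat
  stage :: "'t \<Rightarrow> nat"
  node :: "nat \<Rightarrow> 's"
  input_matrix :: "real^'u^'n"
  x_init :: "real^'n"
  rho_min :: real
  rho_max :: real
  terminal_cost :: "real^'n \<Rightarrow> real"
  control_fun :: "real^'u \<Rightarrow> real"
  stage_cost :: "'t \<Rightarrow> real \<Rightarrow> real"
  boundary :: "real^'n \<Rightarrow> real^'g"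

type_synonym ('n, 'u, 's, 't) trajectory = "((real^'n)^'s) \<times> ((real^'u)^'t) \<times> (real^'t)"

definition problem_data ::
  "('n::finite, 'u::finite, 'g::finite, 's::finite, 't::finite) problem \<Rightarrow> bool" where
  "problem_data P \<longleftrightarrow>
     horizon P \<ge> 1 \<and>
     bij_betw (stage P) UNIV {1..horizon P} \<and>
     bij_betw (node P) {1..horizon P + 1} UNIV \<and>
     convex_on UNIV (terminal_cost P) \<and> cont_differentiable (terminal_cost P) \<and>
     convex_on UNIV (control_fun P) \<and> cont_differentiable (control_fun P) \<and>
     (\<forall>t. convex_on UNIV (stage_cost P t) \<and> stage_cost P t C1_differentiable_on UNIV) \<and>
     affine_map (boundary P)"

definition control_set ::
  "('n::finite, 'u::finite, 'g::finite, 's::finite, 't::finite) problem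
     \<Rightarrow> ((real^'u) \<times> real) set" where
  "control_set P = {(u, \<sigma>). rho_min P \<le> \<sigma> \<and> \<sigma> \<le> rho_max P \<and> control_fun P u \<le> \<sigma>}"

definition trajectory_set ::
  "('n::finite, 'u::finite, 'g::finite, 's::finite, 't::finite) problem
     \<Rightarrow> ('n, 'u, 's, 't) trajectory set" where
  "trajectory_set P = {(x, u, \<sigma>). \<forall>t. (u $ t, \<sigma> $ t) \<in> control_set P}"

definition eq_constraints ::
  "('n::finite, 'u::finite, 'g::finite, 's::finite, 't::finite) problem \<Rightarrow> real^'n^'n
     \<Rightarrow> ('n, 'u, 's, 't) trajectory \<Rightarrow> ((real^'n)^'t) \<times> (real^'n) \<times> (real^'g)" where
  "eq_constraints P A = (\<lambda>(x, u, \<sigma>).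
     ((\<chi> t. x $ node P (stage P t + 1)
             - (A *v (x $ node P (stage P t)) + input_matrix P *v (u $ t))),
      x $ node P 1 - x_init P,
      boundary P (x $ node P (horizon P + 1))))"

definition feasible ::
  "('n::finite, 'u::finite, 'g::finite, 's::finite, 't::finite) problem \<Rightarrow> real^'n^'n
     \<Rightarrow> ('n, 'u, 's, 't) trajectory \<Rightarrow> bool" where
  "feasible P A z \<longleftrightarrow> z \<in> trajectory_set P \<and> eq_constraints P A z = 0"

definition total_cost ::
  "('n::finite, 'u::finite, 'g::finite, 's::finite, 't::finite) problem
     \<Rightarrow> ('n, 'u, 's, 't) trajectory \<Rightarrow> real" where
  "total_cost P = (\<lambda>(x, u, \<sigma>).
     terminal_cost P (x $ node P (horizon P + 1)) + (\<Sum>t\<in>UNIV. stage_cost P t (\<sigma> $ t)))"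

definition optimal ::
  "('n::finite, 'u::finite, 'g::finite, 's::finite, 't::finite) problem \<Rightarrow> real^'n^'n
     \<Rightarrow> ('n, 'u, 's, 't) trajectory \<Rightarrow> bool" where
  "optimal P A z \<longleftrightarrow>
     feasible P A z \<and> (\<forall>z'. feasible P A z' \<longrightarrow> total_cost P z \<le> total_cost P z')"

text \<open>The reduced problem: minimize the terminal cost subject to the boundary condition only.\<close>

definition terminal_minimizer ::
  "('n::finite, 'u::finite, 'g::finite, 's::finite, 't::finite) problem \<Rightarrow> real^'n \<Rightarrow> bool" where
  "terminal_minimizer P y \<longleftrightarrow>
     boundary P y = 0 \<and> (\<forall>y'. boundary P y' = 0 \<longrightarrow> terminal_cost P y \<le> terminal_cost P y')"

section \<open>The assumptions\<close>

definition regularity ::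
  "('n::finite, 'u::finite, 'g::finite, 's::finite, 't::finite) problem \<Rightarrow> bool" where
  "regularity P \<longleftrightarrow>
     (\<forall>t. stage_cost P t C1_differentiable_on {rho_min P..} \<and>
          strict_mono_on {rho_min P..} (stage_cost P t)) \<and>
     cont_differentiable (terminal_cost P) \<and>
     {u :: (real^'u)^'t. \<forall>t. control_fun P (u $ t) \<le> rho_min P} \<noteq> {} \<and>
     compact {u :: (real^'u)^'t. \<forall>t. control_fun P (u $ t) \<le> rho_max P}"

text \<open>
  Column \<open>(k, j)\<close> of the controllability matrix is column \<open>j\<close> of \<open>A\<^bsup>idx k\<^esup> B\<close>.  The power is
  iterated matrix multiplication; the overloaded power on vectors is componentwise.
\<close>

definition controllability_matrix ::
  "('n::finite \<Rightarrow> nat) \<Rightarrow> real^'n^'n \<Rightarrow> (real^'u::finite)^'n \<Rightarrow> real^('n \<times> 'u)^'n" where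
  "controllability_matrix idx A B =
     (\<chi> i c. (((\<lambda>M. A ** M) ^^ idx (fst c)) B) $ i $ snd c)"

definition controllable ::
  "('n::finite \<Rightarrow> nat) \<Rightarrow> real^'n^'n \<Rightarrow> (real^'u::finite)^'n \<Rightarrow> bool" where
  "controllable idx A B \<longleftrightarrow> rank (controllability_matrix idx A B) = CARD('n)"

text \<open>
  The rows of the Jacobian of a map between Euclidean spaces, that is, the gradients of its
  coordinate functions; on \<open>real^'n\<close> these are the rows of \<open>jacobian f (at z)\<close>.
\<close>

definition jacobian_row ::
  "('a::euclidean_space \<Rightarrow> 'b::euclidean_space) \<Rightarrow> 'a \<Rightarrow> 'b \<Rightarrow> 'a" where
  "jacobian_row f z b = (\<Sum>c\<in>Basis. (frechet_derivative f (at z) c \<bullet> b) *\<^sub>R c)"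

definition full_row_rank_at ::
  "('a::euclidean_space \<Rightarrow> 'b::euclidean_space) \<Rightarrow> 'a \<Rightarrow> bool" where
  "full_row_rank_at f z \<longleftrightarrow> dim (jacobian_row f z ` Basis) = DIM('b)"

definition full_rank ::
  "('n::finite, 'u::finite, 'g::finite, 's::finite, 't::finite) problem \<Rightarrow> real^'n^'n \<Rightarrow> bool" where
  "full_rank P A \<longleftrightarrow> (\<forall>z. full_row_rank_at (eq_constraints P A) z)"

definition slater ::
  "('n::finite, 'u::finite, 'g::finite, 's::finite, 't::finite) problem \<Rightarrow> real^'n^'n \<Rightarrow> bool" where
  "slater P A \<longleftrightarrow> (\<exists>z \<in> interior (trajectory_set P). eq_constraints P A z = 0)"

definition normality ::
  "('n::finite, 'u::finite, 'g::finite, 's::finite, 't::finite) problem \<Rightarrow> real^'n^'n \<Rightarrow> bool" where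
  "normality P A \<longleftrightarrow>
     (\<forall>x u \<sigma>. optimal P A (x, u, \<sigma>) \<longrightarrow>
        (\<exists>t. \<sigma> $ t > rho_min P) \<or> \<not> terminal_minimizer P (x $ node P (horizon P + 1)))"

definition all_assumptions ::
  "('n::finite \<Rightarrow> nat) \<Rightarrow> ('n, 'u::finite, 'g::finite, 's::finite, 't::finite) problem
     \<Rightarrow> real^'n^'n \<Rightarrow> bool" where
  "all_assumptions idx P A \<longleftrightarrow>
     regularity P \<and> controllable idx A (input_matrix P) \<and> full_rank P A \<and> slater P A \<and>
     normality P A"

end

theory Submission
  imports Defs
begin

text \<open>The assumptions depend on \<open>q\<close> only through the system matrix, which is continuous in \<open>q\<close>, so it
  suffices that each of them is an open condition on that matrix. Controllability and full rank say
  that a linear map is onto. A small change of a surjective linear map has right inverses bounded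
  uniformly, which also repairs the Slater point. Normality is open by a compactness argument.\<close>

section \<open>Linear maps close to a surjective one\<close>

text \<open>For a right inverse \<open>R\<close> of \<open>L0\<close>, the maps
  \<open>L p \<circ> R\<close> tend to the identity on the finite basis. Once within 1/2 of it in
  operator norm they are bijective with inverses of norm at most 2. Neither \<open>R\<close> nor the
  factor 2 depends on \<open>p\<close>.\<close>

lemma eventually_bounded_right_inverse:
  fixes L :: "'p \<Rightarrow> 'a::euclidean_space \<Rightarrow> 'b::euclidean_space"
  assumes lin: "\<And>p. linear (L p)" and lin0: "linear L0" and surj: "surj L0"
    and lim: "\<And>z. ((\<lambda>p. L p z) \<longlongrightarrow> L0 z) F"
  obtains R :: "'b \<Rightarrow> 'a" where "linear R"
    "eventually (\<lambda>p. \<forall>y. \<exists>w. L p (R w) = y \<and> norm w \<le> 2 * norm y) F"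
proof -
  obtain R :: "'b \<Rightarrow> 'a" where R: "linear R" "L0 \<circ> R = id"
    using linear_surjective_right_inverse[OF lin0 surj] by blast
  have R0: "L0 (R w) = w" for w
    using R(2) by (metis comp_apply id_apply)
  \<comment> \<open>Each coordinate of \<open>w\<close> is at most \<open>norm w\<close>, so the
    \<open>DIM('b)\<close> terms of the basis expansion below add up to at most
    \<open>norm w / 2\<close>.\<close>
  define e where "e = 1 / (2 * real DIM('b))"
  have e: "e > 0" by (simp add: e_def)
  have "eventually (\<lambda>p. \<forall>b\<in>Basis. norm (L p (R b) - b) < e) F"
  proof (rule eventually_ball_finite)
    show "\<forall>b\<in>Basis. eventually (\<lambda>p. norm (L p (R b) - b) < e) F"
    proof
      fix b :: 'b
      have "eventually (\<lambda>p. dist (L p (R b)) (L0 (R b)) < e) F"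
        by (rule tendstoD[OF lim e])
      then show "eventually (\<lambda>p. norm (L p (R b) - b) < e) F"
        by (simp only: R0 dist_norm)
    qed
  qed simp
  then have "eventually (\<lambda>p. \<forall>y. \<exists>w. L p (R w) = y \<and> norm w \<le> 2 * norm y) F"
  proof (rule eventually_mono)
    fix p
    assume p: "\<forall>b\<in>Basis. norm (L p (R b) - b) < e"
    have linT: "linear (\<lambda>w. L p (R w) - w)"
      using linear_compose[OF R(1) lin] linear_compose_sub[of "L p \<circ> R" "\<lambda>w. w"] linear_ident
      by (simp add: o_def)
    have bound: "norm (L p (R w) - w) \<le> norm w / 2" for w
    proof -
      have "L p (R w) - w = (\<lambda>w. L p (R w) - w) (\<Sum>b\<in>Basis. (w \<bullet> b) *\<^sub>R b)"
        by (simp add: euclidean_representation)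
      also have "\<dots> = (\<Sum>b\<in>Basis. (w \<bullet> b) *\<^sub>R (L p (R b) - b))"
        by (simp only: linear_sum[OF linT] linear_cmul[OF linT])
      also have "norm \<dots> \<le> (\<Sum>b\<in>(Basis :: 'b set). norm w * e)"
      proof (rule sum_norm_le)
        fix b :: 'b assume b: "b \<in> Basis"
        show "norm ((w \<bullet> b) *\<^sub>R (L p (R b) - b)) \<le> norm w * e"
          unfolding norm_scaleR real_norm_def
          using Basis_le_norm[OF b, of w] less_imp_le[OF bspec[OF p b]]
          by (intro mult_mono) auto
      qed
      also have "\<dots> = norm w / 2" by (simp add: e_def)
      finally show ?thesis .
    qed
    \<comment> \<open>By the reverse triangle inequality half of \<open>norm w\<close> survives.
      This yields both injectivity and the bound on the preimage.\<close>
    have est: "norm w \<le> 2 * norm (L p (R w))" for w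
      using bound[of w] norm_triangle_ineq2[of w "L p (R w)"] by (simp add: norm_minus_commute)
    have linLR: "linear (\<lambda>w. L p (R w))"
      using linear_compose[OF R(1) lin] by (simp add: o_def)
    have "inj (\<lambda>w. L p (R w))"
      unfolding linear_injective_0[OF linLR]
    proof (intro allI impI)
      fix w assume "L p (R w) = 0"
      then show "w = 0" using est[of w] by simp
    qed
    then have onto: "surj (\<lambda>w. L p (R w))"
      by (rule linear_injective_imp_surjective[OF linLR _ refl])
    show "\<forall>y. \<exists>w. L p (R w) = y \<and> norm w \<le> 2 * norm y"
    proof
      fix y
      obtain w where "y = L p (R w)"
        using onto by (rule surjE)
      then show "\<exists>w. L p (R w) = y \<and> norm w \<le> 2 * norm y"
        using est[of w] by blast
    qed
  qed
  with R(1) that show thesis by blast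
qed

lemma eventually_surj:
  fixes L :: "'p \<Rightarrow> 'a::euclidean_space \<Rightarrow> 'b::euclidean_space"
  assumes "\<And>p. linear (L p)" "linear L0" "surj L0" "\<And>z. ((\<lambda>p. L p z) \<longlongrightarrow> L0 z) F"
  shows "eventually (\<lambda>p. surj (L p)) F"
proof -
  obtain R :: "'b \<Rightarrow> 'a" where "eventually (\<lambda>p. \<forall>y. \<exists>w. L p (R w) = y \<and> norm w \<le> 2 * norm y) F"
    by (rule eventually_bounded_right_inverse[OF assms])
  then show ?thesis
  proof (rule eventually_mono)
    fix p
    assume "\<forall>y. \<exists>w. L p (R w) = y \<and> norm w \<le> 2 * norm y"
    then show "surj (L p)" unfolding surj_def by metis
  qed
qed

section \<open>Full row rank of a Jacobian as surjectivity\<close>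

text \<open>The kernel of the adjoint is the orthogonal complement of the range, and in finite
  dimension this complement is trivial only if the range is everything.\<close>

lemma inj_adjoint_iff_surj:
  fixes L :: "'a::euclidean_space \<Rightarrow> 'b::euclidean_space"
  assumes L: "linear L"
  shows "inj (adjoint L) \<longleftrightarrow> surj L"
proof
  assume inj: "inj (adjoint L)"
  show "surj L"
  proof (rule ccontr)
    assume "\<not> surj L"
    moreover have "span (range L) = range L"
      using linear_subspace_image[OF L subspace_UNIV] by (simp only: span_eq_iff)
    ultimately have "span (range L) \<noteq> UNIV" by metis
    then have "dim (range L) < DIM('b)"
      using dim_eq_full[of "range L"] dim_subset_UNIV[of "range L"] by simp
    then obtain y where y: "y \<noteq> 0" "\<And>v. v \<in> span (range L) \<Longrightarrow> orthogonal y v"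
      using orthogonal_to_subspace_exists by blast
    have "L x \<bullet> y = 0" for x
      using y(2)[OF span_base[OF rangeI[of L x]]] by (simp add: orthogonal_def inner_commute)
    then have "adjoint L y = 0"
      using adjoint_works[OF L, of "adjoint L y" y] by simp
    with inj y(1) show False
      using linear_injective_0[OF adjoint_linear[OF L]] by blast
  qed
next
  assume surj: "surj L"
  have "y = 0" if "adjoint L y = 0" for y
  proof -
    obtain x where "y = L x" using surj by blast
    then show ?thesis
      using adjoint_works[OF L, of x y] that by simp
  qed
  then show "inj (adjoint L)"
    using linear_injective_0[OF adjoint_linear[OF L]] by blast
qed

lemma dim_image_Basis_iff_inj:
  fixes f :: "'b::euclidean_space \<Rightarrow> 'a::euclidean_space"
  assumes f: "linear f"
  shows "dim (f ` Basis) = DIM('b) \<longleftrightarrow> inj f"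
proof
  assume dim: "dim (f ` Basis) = DIM('b)"
  obtain S where S: "S \<subseteq> f ` Basis" "independent S" "card S = dim (f ` Basis)"
    by (metis basis_exists)
  have le: "card (f ` Basis) \<le> DIM('b)" by (rule card_image_le) simp
  \<comment> \<open>The independent set \<open>S\<close> has \<open>DIM('b)\<close> elements, which
    is also the most that the image can have. So \<open>S\<close> is the whole image and no two
    basis vectors share a value.\<close>
  have S_eq: "S = f ` Basis"
    by (rule card_seteq) (use S dim le in auto)
  then have "inj_on f Basis"
    using S(3) dim by (intro eq_card_imp_inj_on) auto
  then show "inj f"
    using linear_inj_on_span_iff_independent_image[OF f, of Basis] S(2) S_eq by simp
next
  assume "inj f"
  then show "dim (f ` Basis) = DIM('b)"
    using dim_image_eq[OF f, of Basis] dim_eq_card_independent[OF independent_Basis[where 'a='b]] by simp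
qed

text \<open>The gradient of a coordinate of \<open>f\<close> is the adjoint of the linear part
  applied to that basis vector. Row rank thus measures injectivity of the adjoint, the same at every
  \<open>z\<close>.\<close>

lemma full_row_rank_at_affine_iff:
  fixes f :: "'a::euclidean_space \<Rightarrow> 'b::euclidean_space"
  assumes L: "linear (\<lambda>x. f x - f 0)"
  shows "full_row_rank_at f z \<longleftrightarrow> surj (\<lambda>x. f x - f 0)"
proof -
  let ?L = "\<lambda>x. f x - f 0"
  have "((\<lambda>x. ?L x + f 0) has_derivative ?L) (at z)"
    by (intro has_derivative_add_const linear_imp_has_derivative L)
  then have D: "frechet_derivative f (at z) = ?L"
    by (intro frechet_derivative_at[symmetric]) simp
  have "jacobian_row f z = adjoint ?L"
  proof
    fix b
    have "jacobian_row f z b = (\<Sum>c\<in>Basis. (adjoint ?L b \<bullet> c) *\<^sub>R c)"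
      unfolding jacobian_row_def D using adjoint_works[OF L]
      by (intro sum.cong) (auto simp: inner_commute)
    then show "jacobian_row f z b = adjoint ?L b"
      by (simp add: euclidean_representation)
  qed
  then show ?thesis
    unfolding full_row_rank_at_def
    using dim_image_Basis_iff_inj[OF adjoint_linear[OF L]] inj_adjoint_iff_surj[OF L] by simp
qed

section \<open>Continuity\<close>

lemma tendsto_matrix_mult:
  fixes f :: "'p \<Rightarrow> 'a::real_normed_field^'n^'m" and g :: "'p \<Rightarrow> 'a^'k^'n"
  assumes "(f \<longlongrightarrow> a) F" "(g \<longlongrightarrow> b) F"
  shows "((\<lambda>p. f p ** g p) \<longlongrightarrow> a ** b) F"
  unfolding matrix_matrix_mult_def
  by (intro vec_tendstoI) (auto intro!: tendsto_sum tendsto_mult tendsto_vec_nth assms)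

lemma tendsto_matrix_vector_mult:
  fixes f :: "'p \<Rightarrow> 'a::real_normed_field^'n^'m" and g :: "'p \<Rightarrow> 'a^'n"
  assumes "(f \<longlongrightarrow> a) F" "(g \<longlongrightarrow> b) F"
  shows "((\<lambda>p. f p *v g p) \<longlongrightarrow> a *v b) F"
  unfolding matrix_vector_mult_def
  by (intro vec_tendstoI) (auto intro!: tendsto_sum tendsto_mult tendsto_vec_nth assms)

lemma tendsto_controllability_matrix:
  assumes "(M \<longlongrightarrow> A) F"
  shows "((\<lambda>p. controllability_matrix idx (M p) B) \<longlongrightarrow> controllability_matrix idx A B) F"
proof -
  have "((\<lambda>p. ((\<lambda>X. M p ** X) ^^ k) B) \<longlongrightarrow> ((\<lambda>X. A ** X) ^^ k) B) F" for k
    by (induction k) (auto intro!: tendsto_matrix_mult assms)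
  then show ?thesis
    unfolding controllability_matrix_def
    by (intro vec_tendstoI) (auto intro!: tendsto_vec_nth)
qed

lemma affine_map_tendsto:
  fixes f :: "'a::euclidean_space \<Rightarrow> 'b::real_normed_vector"
  assumes "affine_map f" "(z \<longlongrightarrow> z0) F"
  shows "((\<lambda>p. f (z p)) \<longlongrightarrow> f z0) F"
proof -
  obtain L c where L: "linear L" and f: "f = (\<lambda>x. L x + c)"
    using assms(1) by (auto simp: affine_map_def)
  have "bounded_linear L"
    using L by (simp add: linear_conv_bounded_linear)
  then show ?thesis
    unfolding f by (intro tendsto_add tendsto_const bounded_linear.tendsto[OF _ assms(2)])
qed

lemma cont_differentiable_tendsto:
  assumes "cont_differentiable f" "(z \<longlongrightarrow> z0) F"
  shows "((\<lambda>p. f (z p)) \<longlongrightarrow> f z0) F"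
proof -
  have "isCont f z0"
    using assms(1) has_derivative_continuous by (fastforce simp: cont_differentiable_def)
  then show ?thesis
    using assms(2) by (rule isCont_tendsto_compose)
qed

text \<open>Matrix and trajectory vary together: the rank and Slater conditions use it at a fixed
  trajectory, the compactness argument for normality along a moving one.\<close>

lemma tendsto_eq_constraints:
  assumes "affine_map (boundary P)" "(M \<longlongrightarrow> A) F" "(z \<longlongrightarrow> z0) F"
  shows "((\<lambda>p. eq_constraints P (M p) (z p)) \<longlongrightarrow> eq_constraints P A z0) F"
  unfolding eq_constraints_def case_prod_beta
  by (intro tendsto_Pair vec_tendstoI affine_map_tendsto[OF assms(1)], unfold vec_lambda_beta)
     (intro tendsto_diff tendsto_add tendsto_matrix_vector_mult tendsto_vec_nth tendsto_fst
       tendsto_snd tendsto_const assms)+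

text \<open>The constants, \<open>x_init\<close> and the offset of the boundary map, cancel in the
  difference.\<close>

lemma linear_eq_constraints:
  assumes "affine_map (boundary P)"
  shows "linear (\<lambda>z. eq_constraints P A z - eq_constraints P A 0)"
proof -
  obtain L c where L: "linear L" and c: "boundary P = (\<lambda>x. L x + c)"
    using assms by (auto simp: affine_map_def)
  show ?thesis
    by (rule linearI)
      (auto simp: eq_constraints_def case_prod_beta c linear_add[OF L] linear_cmul[OF L]
        linear_0[OF L] vec_eq_iff matrix_vector_right_distrib matrix_vector_mult_scaleR
        scaleR_right_diff_distrib algebra_simps)
qed

section \<open>Openness of the individual assumptions\<close>

lemma controllable_open:
  assumes "controllable idx A B"
  shows "eventually (\<lambda>M. controllable idx M B) (nhds A)"
proof -
  have "eventually (\<lambda>M. surj ((*v) (controllability_matrix idx M B))) (nhds A)"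
  proof (rule eventually_surj)
    show "surj ((*v) (controllability_matrix idx A B))"
      using assms by (simp add: controllable_def full_rank_surjective)
  qed (auto intro!: tendsto_matrix_vector_mult tendsto_controllability_matrix
        tendsto_const filterlim_ident matrix_vector_mul_linear)
  then show ?thesis
    by (simp add: controllable_def full_rank_surjective)
qed

lemma tendsto_eq_constraints_linear_part:
  assumes "affine_map (boundary P)"
  shows "((\<lambda>M. eq_constraints P M z - eq_constraints P M 0)
    \<longlongrightarrow> eq_constraints P A z - eq_constraints P A 0) (nhds A)"
  by (intro tendsto_diff tendsto_eq_constraints assms tendsto_const filterlim_ident)

lemma full_rank_open:
  assumes "affine_map (boundary P)" "full_rank P A"
  shows "eventually (\<lambda>M. full_rank P M) (nhds A)"
proof -
  note iff = full_row_rank_at_affine_iff[OF linear_eq_constraints[OF assms(1)]]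
  have "eventually (\<lambda>M. surj (\<lambda>z. eq_constraints P M z - eq_constraints P M 0)) (nhds A)"
  proof (rule eventually_surj)
    show "surj (\<lambda>z. eq_constraints P A z - eq_constraints P A 0)"
      using assms(2) by (simp add: full_rank_def iff)
  qed (rule linear_eq_constraints[OF assms(1)] tendsto_eq_constraints_linear_part[OF assms(1)])+
  then show ?thesis
    by (simp add: full_rank_def iff)
qed

text \<open>A Slater point \<open>z0\<close> is corrected to \<open>z0 + R w\<close>, where \<open>R w\<close> is small because the
  residual of \<open>z0\<close> is.\<close>

lemma slater_open:
  fixes P :: "('n::finite, 'u::finite, 'g::finite, 's::finite, 't::finite) problem"
  assumes aff: "affine_map (boundary P)" and rank: "full_rank P A" and slater: "slater P A"
  shows "eventually (\<lambda>M. slater P M) (nhds A)"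
proof -
  let ?L = "\<lambda>M z. eq_constraints P M z - eq_constraints P M 0"
  obtain z0 where z0: "z0 \<in> interior (trajectory_set P)" "eq_constraints P A z0 = 0"
    using slater by (auto simp: slater_def)
  have surj: "surj (?L A)"
    using rank full_row_rank_at_affine_iff[OF linear_eq_constraints[OF aff]]
    by (simp add: full_rank_def)
  obtain R :: "((real^'n)^'t) \<times> (real^'n) \<times> (real^'g) \<Rightarrow> ('n, 'u, 's, 't) trajectory"
    where R: "linear R" "eventually (\<lambda>M. \<forall>y. \<exists>w. ?L M (R w) = y \<and> norm w \<le> 2 * norm y) (nhds A)"
    using eventually_bounded_right_inverse[of ?L "?L A" "nhds A",
        OF linear_eq_constraints[OF aff] linear_eq_constraints[OF aff] surj
          tendsto_eq_constraints_linear_part[OF aff]] by blast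
  obtain e where e: "e > 0" "ball z0 e \<subseteq> interior (trajectory_set P)"
    using z0(1) open_interior open_contains_ball by metis
  obtain K where K: "K > 0" "\<And>w. norm (R w) \<le> K * norm w"
    using linear_bounded_pos[OF R(1)] by metis
  have "((\<lambda>M. eq_constraints P M z0) \<longlongrightarrow> 0) (nhds A)"
    using tendsto_eq_constraints[OF aff filterlim_ident tendsto_const[of z0],
        where A = A] z0(2) by simp
  \<comment> \<open>The correction has norm at most \<open>K\<close> times twice the residual, so a
    residual below this tolerance keeps it inside the ball of radius \<open>e\<close>.\<close>
  moreover have "e / (2 * K) > 0" using e K by simp
  ultimately have "eventually (\<lambda>M. dist (eq_constraints P M z0) 0 < e / (2 * K)) (nhds A)"
    by (rule tendstoD)
  with R(2) show ?thesis
  proof eventually_elim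
    case (elim M)
    obtain w where w: "?L M (R w) = - eq_constraints P M z0"
      "norm w \<le> 2 * norm (eq_constraints P M z0)"
      using elim(1)[rule_format, of "- eq_constraints P M z0"] by auto
    have "norm (R w) \<le> K * norm w" by (rule K)
    also have "\<dots> \<le> K * (2 * norm (eq_constraints P M z0))"
      using w(2) K(1) by simp
    also have "\<dots> < e"
      using elim(2) K(1) by (simp add: dist_norm field_simps)
    finally have "z0 + R w \<in> interior (trajectory_set P)"
      using e(2) by (auto simp: dist_norm)
    \<comment> \<open>The constraints are affine, so the correction changes their value at
      \<open>z0\<close> by exactly \<open>?L M (R w)\<close>, chosen as the negative of the
      residual.\<close>
    moreover have "?L M (z0 + R w) = ?L M z0 + ?L M (R w)"
      by (rule linear_add[OF linear_eq_constraints[OF aff]])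
    then have "eq_constraints P M (z0 + R w) = 0"
      using w(1) by simp
    ultimately show ?case
      by (auto simp: slater_def)
  qed
qed

text \<open>Optimal solutions violating normality have all \<open>\<sigma>\<^sub>i = \<rho>\<^sub>m\<^sub>i\<^sub>n\<close>, so their controls stay in a
  compact set and a subsequence of them converges, along with the states. The limit attains the lower
  bound \<open>min (P7) + \<Sum> l\<^sub>i(\<rho>\<^sub>m\<^sub>i\<^sub>n)\<close> of the cost, hence is optimal and violates normality too.\<close>

lemma normality_open:
  fixes P :: "('n::finite, 'u::finite, 'g::finite, 's::finite, 't::finite) problem"
  assumes data: "problem_data P" and reg: "regularity P" and norm: "normality P A"
  shows "eventually (\<lambda>M. normality P M) (nhds A)"
proof (rule ccontr)
  have aff: "affine_map (boundary P)"
    and stage: "bij_betw (stage P) UNIV {1..horizon P}"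
    and node: "bij_betw (node P) {1..horizon P + 1} UNIV"
    and m: "cont_differentiable (terminal_cost P)"
    and g: "cont_differentiable (control_fun P)"
    using data by (auto simp: problem_data_def)
  assume "\<not> eventually (\<lambda>M. normality P M) (nhds A)"
  \<comment> \<open>Neighbourhoods of \<open>A\<close> are tested by sequences. Passing to a
    subsequence makes normality fail at every index, not just infinitely often.\<close>
  then obtain X where X: "X \<longlonglongrightarrow> A" "\<not> eventually (\<lambda>k. normality P (X k)) sequentially"
    unfolding eventually_nhds_iff_sequentially by blast
  then obtain j :: "nat \<Rightarrow> nat" where j: "strict_mono j" "\<And>k. \<not> normality P (X (j k))"
    using not_eventually_sequentiallyD by blast
  define M where "M = X \<circ> j"
  have M: "M \<longlonglongrightarrow> A" "\<And>k. \<not> normality P (M k)"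
    using LIMSEQ_subseq_LIMSEQ[OF X(1) j(1)] j(2) by (simp_all add: M_def)
  have "\<exists>z. optimal P (M k) z \<and> (\<forall>t. snd (snd z) $ t \<le> rho_min P) \<and>
      terminal_minimizer P (fst z $ node P (horizon P + 1))" for k
    using M(2)[of k] by (force simp: normality_def not_less)
  then obtain z where z: "\<And>k. optimal P (M k) (z k)"
      "\<And>k t. snd (snd (z k)) $ t \<le> rho_min P"
      "\<And>k. terminal_minimizer P (fst (z k) $ node P (horizon P + 1))"
    by metis
  define x u where "x k = fst (z k)" and "u k = fst (snd (z k))" for k
  have traj: "z k \<in> trajectory_set P" and eq: "eq_constraints P (M k) (z k) = 0" for k
    using z(1) by (auto simp: optimal_def feasible_def)
  have V: "rho_min P \<le> snd (snd (z k)) $ t" "snd (snd (z k)) $ t \<le> rho_max P"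
    "control_fun P (u k $ t) \<le> snd (snd (z k)) $ t" for k t
    using traj[of k] by (auto simp: trajectory_set_def control_set_def u_def)
  have \<sigma>: "snd (snd (z k)) $ t = rho_min P" for k t
    by (rule antisym[OF z(2) V(1)])
  have u: "control_fun P (u k $ t) \<le> rho_min P" for k t
    using V(3)[of k t] by (simp add: \<sigma>)
  \<comment> \<open>Feasibility orders the two bounds, which puts the controls into the sublevel set
    for \<open>rho_max\<close> that regularity makes compact.\<close>
  have rho: "rho_min P \<le> rho_max P"
    using order_trans[OF V(1,2)] .
  have z_eq: "z k = (x k, u k, \<chi> t. rho_min P)" for k
    by (simp add: prod_eq_iff vec_eq_iff x_def u_def \<sigma>)
  have "compact {u :: (real^'u)^'t. \<forall>t. control_fun P (u $ t) \<le> rho_max P}"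
    using reg by (simp add: regularity_def)
  moreover have "u k \<in> {u. \<forall>t. control_fun P (u $ t) \<le> rho_max P}" for k
    using order_trans[OF u rho] by simp
  ultimately obtain u' r where r: "strict_mono r" and u': "(u \<circ> r) \<longlonglongrightarrow> u'"
    unfolding compact_def by meson
  have Mr: "(\<lambda>k. M (r k)) \<longlonglongrightarrow> A"
    using LIMSEQ_subseq_LIMSEQ[OF M(1) r] by (simp add: o_def)
  have ur: "(\<lambda>k. u (r k)) \<longlonglongrightarrow> u'"
    using u' by (simp add: o_def)
  have step: "x k $ node P (stage P t + 1)
      = M k *v (x k $ node P (stage P t)) + input_matrix P *v (u k $ t)" for k t
  proof -
    have "(\<chi> t. x k $ node P (stage P t + 1)
        - (M k *v (x k $ node P (stage P t)) + input_matrix P *v (u k $ t))) = 0"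
      using eq[of k] by (simp add: z_eq eq_constraints_def zero_prod_def)
    then show ?thesis
      by (metis (no_types, lifting) eq_iff_diff_eq_0 vec_lambda_beta zero_index)
  qed
  have init: "x k $ node P 1 = x_init P" for k
    using eq[of k] by (simp add: z_eq eq_constraints_def zero_prod_def)
  \<comment> \<open>The dynamics determine the states from \<open>x_init\<close> and the controls,
    so convergence passes from each state to the next. The step from \<open>i\<close> to
    \<open>i + 1\<close> uses the stage numbered \<open>i\<close>, which exists because
    \<open>i\<close> is at most the horizon.\<close>
  have conv: "convergent (\<lambda>k. x (r k) $ node P i)" if "1 \<le> i" "i \<le> horizon P + 1" for i
    using that
  proof (induction i rule: nat_induct_at_least)
    case base
    then show ?case by (simp only: init convergent_const)
  next
    case (Suc i)
    then have "i \<in> {1..horizon P}" by auto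
    then obtain t where t: "stage P t = i"
      using stage by (metis bij_betw_imp_surj_on imageE)
    obtain y where "(\<lambda>k. x (r k) $ node P i) \<longlonglongrightarrow> y"
      using Suc by (auto simp: convergent_def)
    then have "(\<lambda>k. M (r k) *v (x (r k) $ node P i) + input_matrix P *v (u (r k) $ t))
        \<longlonglongrightarrow> A *v y + input_matrix P *v (u' $ t)"
      by (intro tendsto_add tendsto_matrix_vector_mult tendsto_const Mr tendsto_vec_nth ur)
    then show ?case
      using step[of _ t] by (auto simp: t convergent_def)
  qed
  have "\<exists>y. (\<lambda>k. x (r k) $ s) \<longlonglongrightarrow> y" for s
  proof -
    obtain i where "i \<in> {1..horizon P + 1}" "s = node P i"
      using node by (metis UNIV_I bij_betw_imp_surj_on imageE)
    then show ?thesis using conv[of i] by (auto simp: convergent_def)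
  qed
  then obtain f where f: "\<And>s. (\<lambda>k. x (r k) $ s) \<longlonglongrightarrow> f s"
    by metis
  define x' where "x' = (\<chi> s. f s)"
  have xr: "(\<lambda>k. x (r k)) \<longlonglongrightarrow> x'"
    by (rule vec_tendstoI) (simp add: x'_def f)
  let ?z = "(x', u', \<chi> t. rho_min P)"
  let ?y = "x' $ node P (horizon P + 1)"
  have zr: "(\<lambda>k. z (r k)) \<longlonglongrightarrow> ?z"
    unfolding z_eq by (intro tendsto_Pair xr ur tendsto_const)
  have "(\<lambda>k. eq_constraints P (M (r k)) (z (r k))) \<longlonglongrightarrow> eq_constraints P A ?z"
    by (rule tendsto_eq_constraints[OF aff Mr zr])
  then have eq': "eq_constraints P A ?z = 0"
    by (simp add: eq LIMSEQ_const_iff)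
  have "control_fun P (u' $ t) \<le> rho_min P" for t
    by (rule LIMSEQ_le_const2[OF cont_differentiable_tendsto[OF g tendsto_vec_nth[OF ur]]])
       (use u in auto)
  then have feas: "feasible P A ?z"
    using eq' rho by (simp add: feasible_def trajectory_set_def control_set_def)
  have "(\<lambda>k. terminal_cost P (x (r k) $ node P (horizon P + 1))) \<longlonglongrightarrow> terminal_cost P ?y"
    by (intro cont_differentiable_tendsto[OF m] tendsto_vec_nth xr)
  \<comment> \<open>(P7) does not involve the system matrix, so the terminal states along the
    sequence are all compared with the same competitors \<open>y'\<close>, and the inequality passes
    to the limit.\<close>
  then have min: "terminal_cost P ?y \<le> terminal_cost P y'" if "boundary P y' = 0" for y'
    by (rule LIMSEQ_le_const2) (use z(3) that in \<open>auto simp: terminal_minimizer_def x_def\<close>)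
  then have term_min: "terminal_minimizer P ?y"
    using eq' by (simp add: terminal_minimizer_def eq_constraints_def zero_prod_def)
  have opt: "optimal P A ?z"
    unfolding optimal_def
  proof (intro conjI feas allI impI)
    fix z' assume z': "feasible P A z'"
    obtain a b c where abc: "z' = (a, b, c)" by (cases z')
    have "stage_cost P t (rho_min P) \<le> stage_cost P t (c $ t)" for t
    proof -
      have "rho_min P \<le> c $ t"
        using z' by (auto simp: abc feasible_def trajectory_set_def control_set_def)
      moreover have "strict_mono_on {rho_min P..} (stage_cost P t)"
        using reg by (simp add: regularity_def)
      ultimately show ?thesis
        using strict_mono_on_leD by fastforce
    qed
    moreover have "boundary P (a $ node P (horizon P + 1)) = 0"
      using z' by (simp add: abc feasible_def eq_constraints_def zero_prod_def)
    ultimately show "total_cost P ?z \<le> total_cost P z'"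
      using min by (simp add: total_cost_def abc add_mono sum_mono)
  qed
  show False
    using norm[unfolded normality_def, rule_format, OF opt] term_min by simp
qed

text \<open>Regularity does not involve the system matrix; the other four assumptions are open
  conditions on it.\<close>

lemma all_assumptions_open:
  assumes "problem_data P" "all_assumptions idx P A"
  shows "eventually (\<lambda>M. all_assumptions idx P M) (nhds A)"
proof -
  have "affine_map (boundary P)"
    using assms(1) by (simp add: problem_data_def)
  then show ?thesis
    using assms unfolding all_assumptions_def
    by (auto intro!: eventually_conj controllable_open full_rank_open slater_open normality_open)
qed

section \<open>The perturbed matrix\<close>

text \<open>Inside the matrix every entry is a diagonal value \<open>f p i\<close> or a constant 0
  or 1. Induction on the blocks locates the entry, and the index bounds keep it within the
  dimensions.\<close>

lemma tendsto_jordan_matrix: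
  assumes "\<And>i. ((\<lambda>p. f p i) \<longlongrightarrow> f0 i) F"
    and "r < sum_list (map fst bs)" "c < sum_list (map fst bs)"
  shows "((\<lambda>p. jordan_matrix (map (\<lambda>(k, i). (k, f p i :: complex)) bs) $$ (r, c))
    \<longlongrightarrow> jordan_matrix (map (\<lambda>(k, i). (k, f0 i)) bs) $$ (r, c)) F"
  using assms(2,3)
proof (induction bs arbitrary: r c)
  case Nil
  then show ?case by simp
next
  case (Cons b bs)
  obtain k i where b: "b = (k, i)" by (cases b)
  \<comment> \<open>The block sizes do not depend on the eigenvalues, so the matrices for all
    \<open>p\<close> and for the limit split at the same place.\<close>
  have size: "sum_list (map fst (map (\<lambda>(k, i). (k, h i :: complex)) bs)) = sum_list (map fst bs)" for h
    by (induction bs) auto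
  show ?case
    using Cons by (auto simp: b jordan_matrix_Cons size[simplified] assms(1))
qed

text \<open>Only the Jordan factor varies with \<open>q\<close>, and \<open>idx\<close> stays within
  its dimensions because the block sizes add up to \<open>CARD('n)\<close>.\<close>

lemma tendsto_pert_matrix:
  fixes idx :: "'n::finite \<Rightarrow> nat" and bs :: "(nat \<times> 'd::finite) list"
  assumes idx: "bij_betw idx UNIV {..<CARD('n)}" and size: "sum_list (map fst bs) = CARD('n)"
  shows "(pert_matrix idx Q bs lam \<longlongrightarrow> pert_matrix idx Q bs lam q0) (nhds q0)"
proof -
  have lt: "idx r < CARD('n)" for r
    using idx by (auto simp: bij_betw_def)
  have "(pert_jordan idx bs lam \<longlongrightarrow> pert_jordan idx bs lam q0) (nhds q0)"
    unfolding pert_jordan_def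
  proof (intro vec_tendstoI, unfold vec_lambda_beta, rule tendsto_jordan_matrix)
    show "((\<lambda>q. lam i + of_real (q $ i)) \<longlongrightarrow> lam i + of_real (q0 $ i)) (nhds q0)" for i
      by (intro tendsto_add tendsto_const tendsto_of_real tendsto_vec_nth filterlim_ident)
  qed (simp_all add: size lt)
  then show ?thesis
    unfolding pert_matrix_def by (intro tendsto_matrix_mult tendsto_const)
qed

lemma tendsto_to_real_matrix:
  assumes "(f \<longlongrightarrow> a) F"
  shows "((\<lambda>p. to_real_matrix (f p)) \<longlongrightarrow> to_real_matrix a) F"
  unfolding to_real_matrix_def map_matrix_def
  by (intro vec_tendstoI) (auto intro!: tendsto_Re tendsto_vec_nth assms)

section \<open>From neighbourhoods to boxes of parameters\<close>

lemma eventually_nhds_0_vec_box: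
  fixes Pr :: "real^'d::finite \<Rightarrow> bool"
  assumes "eventually Pr (nhds 0)"
  shows "\<exists>\<epsilon>>0. \<forall>q. (\<forall>i. - \<epsilon> \<le> q $ i \<and> q $ i \<le> \<epsilon>) \<longrightarrow> Pr q"
proof -
  obtain d where d: "d > 0" "\<And>q. dist q 0 < d \<Longrightarrow> Pr q"
    using assms by (auto simp: eventually_nhds_metric)
  \<comment> \<open>The norm is at most the sum of the absolute coordinates, hence at most
    \<open>d / 2\<close> on the closed box; the factor 2 makes the bound by \<open>d\<close>
    strict.\<close>
  define e where "e = d / (2 * real CARD('d))"
  have "Pr q" if "\<forall>i. - e \<le> q $ i \<and> q $ i \<le> e" for q
  proof -
    have "norm q \<le> (\<Sum>i\<in>UNIV. \<bar>q $ i\<bar>)" by (rule norm_le_l1_cart)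
    also have "\<dots> \<le> (\<Sum>i\<in>(UNIV :: 'd set). e)"
      using that by (intro sum_mono) (auto simp: abs_le_iff minus_le_iff)
    also have "\<dots> = d / 2" by (simp add: e_def)
    also have "\<dots> < d" using d(1) by simp
    finally show ?thesis using d(2) by (simp add: dist_norm)
  qed
  moreover have "e > 0" using d(1) by (simp add: e_def)
  ultimately show ?thesis by blast
qed

theorem lemma17:
  fixes P :: "('n::finite, 'u::finite, 'g::finite, 's::finite, 't::finite) problem"
    and A :: "real^'n^'n"
    and idx :: "'n \<Rightarrow> nat"
    and Q :: "complex^'n^'n"
    and bs :: "(nat \<times> 'd::finite) list"
    and lam :: "'d \<Rightarrow> complex"
  assumes "problem_data P"
    and "bij_betw idx UNIV {..<CARD('n)}"
    and "jordan_decomposition idx A Q bs lam"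
    and "all_assumptions idx P (to_real_matrix (pert_matrix idx Q bs lam 0))"
  shows "\<exists>\<epsilon>>0. \<forall>q::real^'d.
           (\<forall>i. - \<epsilon> \<le> q $ i \<and> q $ i \<le> \<epsilon>) \<and> real_matrix (pert_matrix idx Q bs lam q) \<longrightarrow>
           all_assumptions idx P (to_real_matrix (pert_matrix idx Q bs lam q))"
proof -
  have "sum_list (map fst bs) = CARD('n)"
    using assms(3) by (simp add: jordan_decomposition_def)
  then have "((\<lambda>q. to_real_matrix (pert_matrix idx Q bs lam q))
      \<longlongrightarrow> to_real_matrix (pert_matrix idx Q bs lam 0)) (nhds 0)"
    by (intro tendsto_to_real_matrix tendsto_pert_matrix assms)
  \<comment> \<open>The open condition at the matrix for \<open>q = 0\<close> is pulled back along
    the convergence in \<open>q\<close>.\<close>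
  then have "eventually (\<lambda>q. all_assumptions idx P (to_real_matrix (pert_matrix idx Q bs lam q)))
      (nhds 0)"
    using all_assumptions_open[OF assms(1,4)] by (simp add: filterlim_iff)
  then show ?thesis
    using eventually_nhds_0_vec_box by blast
qed

end
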